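(* Let $u=F\circ\phi$ be a solution of $$(1-u_y^2)u_{xx}+2u_xu_yu_{xy}+(1-u_x^2)u_{yy}=0,$$ where $\phi(x,y)$ is a harmonic function and $F(t)$ is a twice differentiable function of one variable. Then $$\phi(x,y)=\operatorname{Re}\int\frac{d\zeta}{g(\zeta)},$$ where the holomorphic function $g(\zeta)$ is one of the following: (i) $g(\zeta)=a\zeta+c$; (ii) $g(\zeta)=a\,e^{b\zeta}$; (iii) $g(\zeta)=a\sin(b\zeta+c)$. Here $\zeta=x+iy\in\mathbb{C}$ and $a^2,b^2\in\mathbb{R}$, $c\in\mathbb{C}$. Moreover, in this case the function $F(\phi)$ is found from the equation $$F''(\phi)-\frac{\operatorname{Re} g'(\zeta)}{|g(\zeta)|^2}\,F'(\phi)^3=0 .$$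
   Context: The equation is the zero mean curvature equation for graphs $z=u(x,y)$ in Minkowski space $\mathbb{R}^3_1$ with metric $dx^2+dy^2-dz^2$.
   Formalization: u is assumed nonconstant; a², b² real holds only after a rotation and translation of the (x,y)-plane; in the original ζ, (i) has a² real, (ii) has arbitrary complex a, b, and (iii) has a²b² real. *)

theory Defs
  imports "HOL-Complex_Analysis.Complex_Analysis"
begin

text \<open>The plane is identified with \<^typ>\<open>complex\<close>: the point $(x,y)$ is $x + iy$.\<close>

definition dx :: "(complex \<Rightarrow> real) \<Rightarrow> complex \<Rightarrow> real" where
  "dx f z = deriv (\<lambda>x. f (Complex x (Im z))) (Re z)"

definition dy :: "(complex \<Rightarrow> real) \<Rightarrow> complex \<Rightarrow> real" where
  "dy f z = deriv (\<lambda>y. f (Complex (Re z) y)) (Im z)"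

text \<open>\<^const>\<open>deriv\<close> is total, so existence of the first and second partial derivatives has to be
  required separately. The definitions below are used for open \<open>D\<close> only.\<close>

definition twice_differentiable_on :: "(complex \<Rightarrow> real) \<Rightarrow> complex set \<Rightarrow> bool" where
  "twice_differentiable_on f D \<longleftrightarrow>
     f differentiable_on D \<and> dx f differentiable_on D \<and> dy f differentiable_on D"

definition harmonic_on :: "(complex \<Rightarrow> real) \<Rightarrow> complex set \<Rightarrow> bool" where
  "harmonic_on f D \<longleftrightarrow>
     twice_differentiable_on f D \<and>
     continuous_on D (dx (dx f)) \<and> continuous_on D (dy (dx f)) \<and>
     continuous_on D (dx (dy f)) \<and> continuous_on D (dy (dy f)) \<and>
     (\<forall>z\<in>D. dx (dx f) z + dy (dy f) z = 0)"

definition zmc_solution_on :: "(complex \<Rightarrow> real) \<Rightarrow> complex set \<Rightarrow> bool" where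
  "zmc_solution_on u D \<longleftrightarrow>
     twice_differentiable_on u D \<and>
     (\<forall>z\<in>D. (1 - (dy u z)\<^sup>2) * dx (dx u) z + 2 * dx u z * dy u z * dy (dx u) z
             + (1 - (dx u z)\<^sup>2) * dy (dy u) z = 0)"

text \<open>\<open>\<phi> = Re \<integral> d\<zeta>/g(\<zeta>)\<close> on \<open>D\<close>, the indefinite integral being determined up to a constant.
  \<open>D\<close> need not be simply connected: only the real part of the integral has to be path
  independent. Since division by zero yields zero in HOL, \<open>g \<noteq> 0\<close> on \<open>D\<close> is required
  explicitly.\<close>

definition Re_integral_of_reciprocal ::
  "(complex \<Rightarrow> real) \<Rightarrow> (complex \<Rightarrow> complex) \<Rightarrow> complex set \<Rightarrow> bool" where
  "Re_integral_of_reciprocal \<phi> g D \<longleftrightarrow>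
     (\<forall>\<zeta>\<in>D. g \<zeta> \<noteq> 0) \<and>
     (\<forall>\<gamma>. valid_path \<gamma> \<and> path_image \<gamma> \<subseteq> D \<longrightarrow>
        (\<lambda>\<zeta>. 1 / g \<zeta>) contour_integrable_on \<gamma> \<and>
        \<phi> (pathfinish \<gamma>) - \<phi> (pathstart \<gamma>) = Re (contour_integral \<gamma> (\<lambda>\<zeta>. 1 / g \<zeta>)))"

text \<open>The weight \<open>g\<close> expressed in the rectangular coordinate \<open>w\<close> with \<open>\<zeta> = e\<^sup>i\<^sup>\<theta> w + p\<close>: this is
  the function \<open>G\<close> with \<open>dw / G(w) = d\<zeta> / g(\<zeta>)\<close>.\<close>

definition in_moved_coords :: "real \<Rightarrow> complex \<Rightarrow> (complex \<Rightarrow> complex) \<Rightarrow> complex \<Rightarrow> complex" where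
  "in_moved_coords \<theta> p g = (\<lambda>w. cis (- \<theta>) * g (cis \<theta> * w + p))"

end

theory Submission
  imports Defs
begin

text \<open>Put \<open>f = \<phi>\<^sub>x - i \<phi>\<^sub>y\<close>, which is holomorphic, and \<open>g = 1 / f\<close>. For \<open>u = F \<circ> \<phi>\<close> the equation becomes
  \<open>F''(\<phi>) = F'(\<phi>)\<^sup>3 Re g' / |g|\<^sup>2\<close>. Near a point with \<open>\<nabla>u \<noteq> 0\<close>, therefore, \<open>Re g' / |g|\<^sup>2\<close> is constant on the level
  curves of \<open>\<phi>\<close>, and differentiating along these curves gives \<open>Im (g g'' - g'\<^sup>2) = 0\<close>. So the holomorphic
  function \<open>g g'' - g'\<^sup>2\<close> is a real constant; differentiating it gives \<open>(g'' / g)' = 0\<close>, that is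
  \<open>g'' = l g\<close> with \<open>l\<close> constant, whose solutions are the three families. Each solution is entire, so
  \<open>f g = 1\<close> extends to all of \<open>D\<close> by the identity theorem; in particular \<open>\<phi>\<close> has no critical points.\<close>

section \<open>Partial derivatives as values of the real derivative on the plane\<close>

lemma has_derivative_DERIV_horizontal:
  assumes "(f has_derivative f') (at z)"
  shows "((\<lambda>x. f (Complex x (Im z))) has_field_derivative f' 1) (at (Re z))"
proof -
  have "((\<lambda>x. Complex x (Im z)) has_derivative of_real) (at (Re z))"
    unfolding Complex_eq by (auto intro!: derivative_eq_intros)
  moreover have "(f has_derivative f') (at (Complex (Re z) (Im z)))"
    using assms by simp
  ultimately have "((\<lambda>x. f (Complex x (Im z))) has_derivative (\<lambda>t. f' (of_real t))) (at (Re z))"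
    by (rule has_derivative_compose)
  moreover have "f' (of_real t) = f' 1 * t" for t
    using linear_scale[OF has_derivative_linear[OF assms], of t 1] by (simp add: scaleR_conv_of_real)
  ultimately show ?thesis
    by (simp add: has_field_derivative_def)
qed

lemma has_derivative_DERIV_vertical:
  assumes "(f has_derivative f') (at z)"
  shows "((\<lambda>y. f (Complex (Re z) y)) has_field_derivative f' \<i>) (at (Im z))"
proof -
  have "((\<lambda>y. Complex (Re z) y) has_derivative (\<lambda>t. of_real t * \<i>)) (at (Im z))"
    unfolding Complex_eq by (auto intro!: derivative_eq_intros simp: mult.commute)
  moreover have "(f has_derivative f') (at (Complex (Re z) (Im z)))"
    using assms by simp
  ultimately have "((\<lambda>y. f (Complex (Re z) y)) has_derivative (\<lambda>t. f' (of_real t * \<i>))) (at (Im z))"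
    by (rule has_derivative_compose)
  moreover have "f' (of_real t * \<i>) = f' \<i> * t" for t
    using linear_scale[OF has_derivative_linear[OF assms], of t \<i>] by (simp add: scaleR_conv_of_real)
  ultimately show ?thesis
    by (simp add: has_field_derivative_def)
qed

lemma dx_eqI: "(f has_derivative f') (at z) \<Longrightarrow> dx f z = f' 1"
  unfolding dx_def by (intro DERIV_imp_deriv has_derivative_DERIV_horizontal)

lemma dy_eqI: "(f has_derivative f') (at z) \<Longrightarrow> dy f z = f' \<i>"
  unfolding dy_def by (intro DERIV_imp_deriv has_derivative_DERIV_vertical)

text \<open>A real-linear map on the plane is determined by its values at \<open>1\<close> and
  \<open>\<i>\<close>, and for the derivative these are the two partials.\<close>

lemma has_derivative_dx_dy:
  assumes "f differentiable (at z)"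
  shows "(f has_derivative (\<lambda>h. dx f z * Re h + dy f z * Im h)) (at z)"
proof -
  obtain f' where f': "(f has_derivative f') (at z)"
    using assms by (auto simp: differentiable_def)
  have "f' h = dx f z * Re h + dy f z * Im h" for h
  proof -
    have "h = Re h *\<^sub>R 1 + Im h *\<^sub>R \<i>"
      by (simp add: complex_eq_iff)
    then have "f' h = f' (Re h *\<^sub>R 1 + Im h *\<^sub>R \<i>)"
      by (rule arg_cong)
    also have "\<dots> = Re h * f' 1 + Im h * f' \<i>"
      using has_derivative_linear[OF f'] by (simp only: linear_add linear_scale real_scaleR_def)
    finally show ?thesis
      by (simp add: dx_eqI[OF f'] dy_eqI[OF f'])
  qed
  then have "f' = (\<lambda>h. dx f z * Re h + dy f z * Im h)"
    by blast
  with f' show ?thesis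
    by simp
qed

lemma DERIV_dx:
  "f differentiable (at (Complex x y)) \<Longrightarrow>
     ((\<lambda>x. f (Complex x y)) has_field_derivative dx f (Complex x y)) (at x)"
  using has_derivative_DERIV_horizontal[OF has_derivative_dx_dy, of f "Complex x y"] by simp

lemma DERIV_dy:
  "f differentiable (at (Complex x y)) \<Longrightarrow>
     ((\<lambda>y. f (Complex x y)) has_field_derivative dy f (Complex x y)) (at y)"
  using has_derivative_DERIV_vertical[OF has_derivative_dx_dy, of f "Complex x y"] by simp

lemma differentiable_at_of_open:
  "f differentiable_on D \<Longrightarrow> open D \<Longrightarrow> z \<in> D \<Longrightarrow> f differentiable (at z)"
  by (metis differentiable_on_def at_within_open)

section \<open>Equality of the mixed second partials\<close>

text \<open>The mean value theorem is applied twice: in \<open>x\<close> to the difference of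
  \<open>f\<close> between the top and bottom edges, then in \<open>y\<close> to
  \<open>dx f\<close>. The left side is symmetric in the two variables, so exchanging their order
  gives the companion formula with \<open>dx (dy f)\<close>.\<close>

lemma second_difference_eq_dy_dx:
  assumes diff: "\<And>x y. a \<le> x \<Longrightarrow> x \<le> a + h \<Longrightarrow> b \<le> y \<Longrightarrow> y \<le> b + h \<Longrightarrow>
      f differentiable (at (Complex x y)) \<and> dx f differentiable (at (Complex x y))"
    and "h > 0"
  obtains x y where "a < x" "x < a + h" "b < y" "y < b + h"
    "f (Complex (a + h) (b + h)) - f (Complex (a + h) b) - f (Complex a (b + h)) + f (Complex a b)
      = h\<^sup>2 * dy (dx f) (Complex x y)"
proof -
  have "\<exists>x>a. x < a + h \<and>
      (f (Complex (a + h) (b + h)) - f (Complex (a + h) b)) - (f (Complex a (b + h)) - f (Complex a b))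
      = (a + h - a) * (dx f (Complex x (b + h)) - dx f (Complex x b))"
    using assms by (intro MVT2) (auto intro!: derivative_intros DERIV_dx)
  then obtain x where x: "a < x" "x < a + h"
      "(f (Complex (a + h) (b + h)) - f (Complex (a + h) b)) - (f (Complex a (b + h)) - f (Complex a b))
      = h * (dx f (Complex x (b + h)) - dx f (Complex x b))"
    by auto
  have "\<exists>y>b. y < b + h \<and>
      dx f (Complex x (b + h)) - dx f (Complex x b) = (b + h - b) * dy (dx f) (Complex x y)"
    using assms x by (intro MVT2) (auto intro!: DERIV_dy)
  then obtain y where "b < y" "y < b + h"
      "dx f (Complex x (b + h)) - dx f (Complex x b) = h * dy (dx f) (Complex x y)"
    by auto
  with x show ?thesis
    by (intro that[of x y]) (auto simp: power2_eq_square algebra_simps)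
qed

lemma second_difference_eq_dx_dy:
  assumes diff: "\<And>x y. a \<le> x \<Longrightarrow> x \<le> a + h \<Longrightarrow> b \<le> y \<Longrightarrow> y \<le> b + h \<Longrightarrow>
      f differentiable (at (Complex x y)) \<and> dy f differentiable (at (Complex x y))"
    and "h > 0"
  obtains x y where "a < x" "x < a + h" "b < y" "y < b + h"
    "f (Complex (a + h) (b + h)) - f (Complex (a + h) b) - f (Complex a (b + h)) + f (Complex a b)
      = h\<^sup>2 * dx (dy f) (Complex x y)"
proof -
  have "\<exists>y>b. y < b + h \<and>
      (f (Complex (a + h) (b + h)) - f (Complex a (b + h))) - (f (Complex (a + h) b) - f (Complex a b))
      = (b + h - b) * (dy f (Complex (a + h) y) - dy f (Complex a y))"
    using assms by (intro MVT2) (auto intro!: derivative_intros DERIV_dy)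
  then obtain y where y: "b < y" "y < b + h"
      "(f (Complex (a + h) (b + h)) - f (Complex a (b + h))) - (f (Complex (a + h) b) - f (Complex a b))
      = h * (dy f (Complex (a + h) y) - dy f (Complex a y))"
    by auto
  have "\<exists>x>a. x < a + h \<and>
      dy f (Complex (a + h) y) - dy f (Complex a y) = (a + h - a) * dx (dy f) (Complex x y)"
    using assms y by (intro MVT2) (auto intro!: DERIV_dx)
  then obtain x where "a < x" "x < a + h"
      "dy f (Complex (a + h) y) - dy f (Complex a y) = h * dx (dy f) (Complex x y)"
    by auto
  with y show ?thesis
    by (intro that[of x y]) (auto simp: power2_eq_square algebra_simps)
qed

text \<open>Schwarz's theorem: on a small square with corner \<open>z\<close> the two mixed partials
  take a common value, the second difference divided by \<open>h^2\<close>, though at different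
  points. Continuity carries this over to \<open>z\<close>.\<close>

lemma dx_dy_commute:
  assumes "open D" "z \<in> D" "twice_differentiable_on f D"
    and "continuous_on D (dy (dx f))" "continuous_on D (dx (dy f))"
  shows "dy (dx f) z = dx (dy f) z"
proof (rule ccontr)
  \<comment> \<open>Half the gap: two errors below \<open>e\<close>, measured from the common value,
    cannot add up to the gap \<open>2 e\<close>.\<close>
  define e where "e = \<bar>dy (dx f) z - dx (dy f) z\<bar> / 2"
  assume "dy (dx f) z \<noteq> dx (dy f) z"
  then have "e > 0"
    by (simp add: e_def)
  have "isCont (dy (dx f)) z" "isCont (dx (dy f)) z"
    using assms by (auto simp: continuous_on_eq_continuous_at)
  with \<open>e > 0\<close> obtain d1 d2 where d1: "d1 > 0" "\<And>w. dist w z < d1 \<Longrightarrow> dist (dy (dx f) w) (dy (dx f) z) < e"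
    and d2: "d2 > 0" "\<And>w. dist w z < d2 \<Longrightarrow> dist (dx (dy f) w) (dx (dy f) z) < e"
    unfolding continuous_at_eps_delta by metis
  obtain r where r: "r > 0" "ball z r \<subseteq> D"
    using assms(1,2) open_contains_ball by blast
  \<comment> \<open>Points of the square with corner \<open>z\<close> and side \<open>h\<close> are
    at distance at most \<open>2 h < 3 h\<close> from \<open>z\<close>, so the square lies in
    \<open>D\<close> and in both continuity neighbourhoods.\<close>
  define h where "h = min r (min d1 d2) / 3"
  have h: "h > 0" "3 * h \<le> r" "3 * h \<le> d1" "3 * h \<le> d2"
    using r d1 d2 by (auto simp: h_def)
  have near: "dist (Complex x y) z < 3 * h" if "Re z \<le> x" "x \<le> Re z + h" "Im z \<le> y" "y \<le> Im z + h" for x y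
  proof -
    have "dist (Complex x y) z \<le> \<bar>x - Re z\<bar> + \<bar>y - Im z\<bar>"
      unfolding dist_norm using cmod_le[of "Complex x y - z"] by simp
    also have "\<dots> < 3 * h"
      using that h by linarith
    finally show ?thesis .
  qed
  then have inD: "Complex x y \<in> D" if "Re z \<le> x" "x \<le> Re z + h" "Im z \<le> y" "y \<le> Im z + h" for x y
    using near[OF that] h r by (auto simp: dist_commute subset_iff)
  have diff: "f differentiable (at w)" "dx f differentiable (at w)" "dy f differentiable (at w)" if "w \<in> D" for w
    using assms that by (auto simp: twice_differentiable_on_def intro: differentiable_at_of_open)
  obtain x y where xy: "Re z < x" "x < Re z + h" "Im z < y" "y < Im z + h"
    "f (Complex (Re z + h) (Im z + h)) - f (Complex (Re z + h) (Im z)) - f (Complex (Re z) (Im z + h))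
      + f (Complex (Re z) (Im z)) = h\<^sup>2 * dy (dx f) (Complex x y)"
    by (rule second_difference_eq_dy_dx[of "Re z" h "Im z" f]) (use diff inD h in auto)
  obtain x' y' where xy': "Re z < x'" "x' < Re z + h" "Im z < y'" "y' < Im z + h"
    "f (Complex (Re z + h) (Im z + h)) - f (Complex (Re z + h) (Im z)) - f (Complex (Re z) (Im z + h))
      + f (Complex (Re z) (Im z)) = h\<^sup>2 * dx (dy f) (Complex x' y')"
    by (rule second_difference_eq_dx_dy[of "Re z" h "Im z" f]) (use diff inD h in auto)
  have "dy (dx f) (Complex x y) = dx (dy f) (Complex x' y')"
    using xy xy' h by simp
  moreover have "dist (dy (dx f) (Complex x y)) (dy (dx f) z) < e"
    using near[of x y] xy h by (intro d1) auto
  moreover have "dist (dx (dy f) (Complex x' y')) (dx (dy f) z) < e"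
    using near[of x' y'] xy' h by (intro d2) auto
  ultimately have "dist (dy (dx f) z) (dx (dy f) z) < e + e"
    using dist_triangle3[of "dy (dx f) z" "dx (dy f) z" "dy (dx f) (Complex x y)"] by simp
  then show False
    by (simp add: e_def dist_real_def)
qed

section \<open>The complex gradient of a harmonic function and its level curves\<close>

text \<open>The Cauchy-Riemann equations of \<open>\<phi>_x - i \<phi>_y\<close> are Laplace's
  equation and the symmetry of the mixed partials.\<close>

lemma harmonic_on_gradient_has_field_derivative:
  assumes "open D" "harmonic_on \<phi> D" "z \<in> D"
  shows "((\<lambda>z. Complex (dx \<phi> z) (- dy \<phi> z)) has_field_derivative
           Complex (dx (dx \<phi>) z) (- dy (dx \<phi>) z)) (at z)"
proof -
  have "dx \<phi> differentiable (at z)" "dy \<phi> differentiable (at z)"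
    using assms by (auto simp: harmonic_on_def twice_differentiable_on_def intro: differentiable_at_of_open)
  note D = this[THEN has_derivative_dx_dy]
  have comm: "dx (dy \<phi>) z = dy (dx \<phi>) z"
    using dx_dy_commute[of D z \<phi>] assms by (simp add: harmonic_on_def)
  have lap: "dy (dy \<phi>) z = - dx (dx \<phi>) z"
    using assms by (simp add: harmonic_on_def eq_neg_iff_add_eq_0 add.commute)
  have "((\<lambda>z. complex_of_real (dx \<phi> z) - \<i> * complex_of_real (dy \<phi> z)) has_derivative
      (\<lambda>h. Complex (dx (dx \<phi>) z) (- dy (dx \<phi>) z) * h)) (at z)"
    by (rule derivative_eq_intros D refl)+ (auto simp: complex_eq_iff comm lap algebra_simps)
  then show ?thesis
    by (simp add: has_field_derivative_def Complex_eq)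
qed

lemma harmonic_on_has_derivative:
  assumes "open D" "harmonic_on \<phi> D" "z \<in> D"
  shows "(\<phi> has_derivative (\<lambda>h. Re (Complex (dx \<phi> z) (- dy \<phi> z) * h))) (at z)"
proof -
  have "\<phi> differentiable (at z)"
    using assms by (auto simp: harmonic_on_def twice_differentiable_on_def intro: differentiable_at_of_open)
  from has_derivative_dx_dy[OF this] show ?thesis
    by simp
qed

text \<open>Near \<open>z0\<close>, \<open>\<phi>\<close> is up to a constant the real part of a
  primitive \<open>W\<close> of \<open>f\<close>. Since \<open>f z0 \<noteq> 0\<close>,
  \<open>W\<close> has a local inverse \<open>V\<close>, and \<open>V\<close> maps the vertical line
  through \<open>W z0\<close> to the level curve; its velocity is
  \<open>\<i> V'(W z0) = \<i> / f z0\<close>.\<close>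

lemma level_curve:
  assumes "open S" "z0 \<in> S" "f holomorphic_on S" "f z0 \<noteq> 0"
    and deriv: "\<And>z. z \<in> S \<Longrightarrow> (\<phi> has_derivative (\<lambda>h. Re (f z * h))) (at z)"
  obtains \<gamma> where "\<gamma> 0 = z0" "(\<gamma> has_vector_derivative \<i> / f z0) (at 0)"
    "\<forall>\<^sub>F t in nhds (0 :: real). \<gamma> t \<in> S \<and> \<phi> (\<gamma> t) = (\<phi> z0 :: real)"
proof -
  obtain r where r: "r > 0" "ball z0 r \<subseteq> S"
    using assms(1,2) open_contains_ball by blast
  have holo: "f holomorphic_on ball z0 r"
    using assms(3) r holomorphic_on_subset by blast
  obtain W where "\<And>z. z \<in> ball z0 r \<Longrightarrow> (W has_field_derivative f z) (at z within ball z0 r)"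
    using holomorphic_convex_primitive'[OF convex_ball open_ball holo] by blast
  then have W: "(W has_field_derivative f z) (at z)" if "z \<in> ball z0 r" for z
    using that by (metis at_within_open open_ball)
  have W_holo: "W holomorphic_on ball z0 r"
    using W by (meson holomorphic_onI field_differentiable_def field_differentiable_at_within)
  obtain s where s: "s > 0" "ball z0 s \<subseteq> ball z0 r" "inj_on W (ball z0 s)"
    using has_complex_derivative_locally_injective[OF W_holo, of z0] r assms(4) W[of z0]
    by (auto simp: DERIV_imp_deriv)
  have W_holo_s: "W holomorphic_on ball z0 s"
    using W_holo s(2) holomorphic_on_subset by blast
  obtain V where V: "V holomorphic_on (W ` ball z0 s)"
      "\<And>z. z \<in> ball z0 s \<Longrightarrow> deriv W z * deriv V (W z) = 1" "\<And>z. z \<in> ball z0 s \<Longrightarrow> V (W z) = z"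
    using holomorphic_has_inverse[OF W_holo_s open_ball s(3)] by blast
  have z0: "z0 \<in> ball z0 s"
    using s by simp
  have op: "open (W ` ball z0 s)"
    by (rule open_mapping_thm3[OF W_holo_s open_ball s(3)])
  have "deriv V (W z0) = 1 / f z0"
    using V(2)[OF z0] DERIV_imp_deriv[OF W[of z0]] r assms(4) by (simp add: field_simps)
  then have V': "(V has_field_derivative 1 / f z0) (at (W z0))"
    using holomorphic_derivI[OF V(1) op, of "W z0"] z0 by auto
  obtain c where c: "\<And>z. z \<in> ball z0 s \<Longrightarrow> \<phi> z - Re (W z) = c"
  proof -
    have "((\<lambda>z. \<phi> z - Re (W z)) has_derivative (\<lambda>h. 0)) (at z)" if "z \<in> ball z0 s" for z
    proof -
      have "z \<in> S" "z \<in> ball z0 r"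
        using that s r by auto
      then have "((\<lambda>z. \<phi> z - Re (W z)) has_derivative (\<lambda>h. Re (f z * h) - Re (f z * h))) (at z)"
        by (intro derivative_intros deriv W[THEN has_field_derivative_imp_has_derivative]) auto
      then show ?thesis
        by simp
    qed
    from has_derivative_zero_unique_connected[OF open_ball connected_ball this]
    show ?thesis
      using that z0 by metis
  qed
  define \<gamma> where "\<gamma> t = V (W z0 + of_real t * \<i>)" for t :: real
  show ?thesis
  proof (rule that[of \<gamma>])
    show "\<gamma> 0 = z0"
      using V(3)[OF z0] by (simp add: \<gamma>_def)
    have "((\<lambda>t::real. W z0 + of_real t * \<i>) has_vector_derivative \<i>) (at 0)"
      by (auto intro!: derivative_eq_intros simp: has_vector_derivative_def scaleR_conv_of_real)
    from field_vector_diff_chain_at[OF this, of V "1 / f z0"] V'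
    show "(\<gamma> has_vector_derivative \<i> / f z0) (at 0)"
      by (simp add: \<gamma>_def[abs_def] o_def)
    have "((\<lambda>t::real. W z0 + of_real t * \<i>) \<longlongrightarrow> W z0 + of_real 0 * \<i>) (nhds 0)"
      by (intro tendsto_intros filterlim_ident)
    then have "\<forall>\<^sub>F t in nhds 0. W z0 + of_real (t::real) * \<i> \<in> W ` ball z0 s"
      by (rule topological_tendstoD) (use op z0 in auto)
    then show "\<forall>\<^sub>F t in nhds 0. \<gamma> t \<in> S \<and> \<phi> (\<gamma> t) = \<phi> z0"
    proof eventually_elim
      case (elim t)
      then obtain w where w: "w \<in> ball z0 s" "W w = W z0 + of_real t * \<i>"
        by auto
      then have "\<gamma> t = w"
        using V(3)[of w] by (simp add: \<gamma>_def)
      moreover have "\<phi> w = \<phi> z0"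
        using c[OF w(1)] c[OF z0] arg_cong[OF w(2), of Re] by simp
      ultimately show ?case
        using w s r by auto
    qed
  qed
qed

section \<open>Real-valued holomorphic functions and real parts of contour integrals\<close>

text \<open>The differential of \<open>Im f\<close> is \<open>h \<mapsto> Im (f' h)\<close>; its
  vanishing at \<open>1\<close> and at \<open>\<i>\<close> kills the imaginary and the real part of
  \<open>f'\<close>.\<close>

lemma holomorphic_on_Im_zero_deriv_zero:
  assumes "open S" "z \<in> S" "f holomorphic_on S" "\<And>z. z \<in> S \<Longrightarrow> Im (f z) = 0"
  shows "deriv f z = 0"
proof -
  have "((\<lambda>z. Im (f z)) has_derivative (\<lambda>h. Im (deriv f z * h))) (at z)"
    using holomorphic_derivI[OF assms(3,1,2)]
    by (intro derivative_intros has_field_derivative_imp_has_derivative) auto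
  moreover have "((\<lambda>z. Im (f z)) has_derivative (\<lambda>h. 0)) (at z)"
    by (rule has_derivative_transform_within_open[where f = "\<lambda>_. 0", OF _ assms(1,2)])
      (auto simp: assms(4))
  ultimately have "(\<lambda>h. Im (deriv f z * h)) = (\<lambda>h. 0)"
    by (rule has_derivative_unique)
  from fun_cong[OF this, of 1] fun_cong[OF this, of \<i>] show ?thesis
    by (simp add: complex_eq_iff)
qed

text \<open>The real fundamental theorem of calculus is applied to
  \<open>\<phi> \<circ> \<gamma>\<close>, with the finitely many corners of \<open>\<gamma>\<close>
  as exceptional set. Only \<open>\<phi>\<close> serves as a primitive, never a complex one, so
  \<open>D\<close> may be multiply connected.\<close>

lemma contour_integral_gradient:
  assumes "f contour_integrable_on \<gamma>" "valid_path \<gamma>" "path_image \<gamma> \<subseteq> D"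
    and deriv: "\<And>z. z \<in> D \<Longrightarrow> (\<phi> has_derivative (\<lambda>h. Re (f z * h))) (at z)"
  shows "\<phi> (pathfinish \<gamma>) - \<phi> (pathstart \<gamma>) = Re (contour_integral \<gamma> f)"
proof -
  have in_D: "\<gamma> t \<in> D" if "t \<in> {0..1}" for t
    using that assms(3) by (auto simp: path_image_def)
  obtain N where N: "finite N" "\<gamma> C1_differentiable_on ({0..1} - N)" and cont: "continuous_on {0..1} \<gamma>"
    using assms(2) by (auto simp: valid_path_def piecewise_C1_differentiable_on_def)
  have chain: "((\<phi> \<circ> \<gamma>) has_vector_derivative Re (f (\<gamma> t) * vector_derivative \<gamma> (at t))) (at t)"
    if t: "t \<in> {0..1} - N" for t
  proof -
    have in_D': "\<gamma> t \<in> D"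
      using t in_D by blast
    have "(\<gamma> has_vector_derivative vector_derivative \<gamma> (at t)) (at t)"
      using N(2) t by (auto simp: C1_differentiable_on_eq vector_derivative_works)
    then have "((\<lambda>t. \<phi> (\<gamma> t)) has_derivative
        (\<lambda>h. Re (f (\<gamma> t) * (h *\<^sub>R vector_derivative \<gamma> (at t))))) (at t)"
      unfolding has_vector_derivative_def
      by (rule has_derivative_compose) (rule deriv[OF in_D'])
    then show ?thesis
      by (simp add: has_vector_derivative_def o_def)
  qed
  have "continuous_on D \<phi>"
    using deriv by (meson continuous_at_imp_continuous_on has_derivative_continuous)
  then have "continuous_on {0..1} (\<phi> \<circ> \<gamma>)"
    using cont in_D by (intro continuous_on_compose) (auto elim: continuous_on_subset)
  from fundamental_theorem_of_calculus_strong[OF N(1) zero_le_one chain this]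
  have "((\<lambda>t. Re (f (\<gamma> t) * vector_derivative \<gamma> (at t))) has_integral
      \<phi> (pathfinish \<gamma>) - \<phi> (pathstart \<gamma>)) {0..1}"
    by (simp add: pathfinish_def pathstart_def)
  moreover have "((\<lambda>t. f (\<gamma> t) * vector_derivative \<gamma> (at t)) has_integral contour_integral \<gamma> f) {0..1}"
    using has_contour_integral_integral[OF assms(1)] by (simp add: has_contour_integral)
  from has_integral_linear[OF this bounded_linear_Re]
  have "((\<lambda>t. Re (f (\<gamma> t) * vector_derivative \<gamma> (at t))) has_integral Re (contour_integral \<gamma> f)) {0..1}"
    by (simp add: o_def)
  ultimately show ?thesis
    by (rule has_integral_unique)
qed

lemma constant_of_DERIV_zero:
  fixes f :: "complex \<Rightarrow> complex"
  assumes "open S" "connected S" "\<And>z. z \<in> S \<Longrightarrow> (f has_field_derivative 0) (at z)"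
  obtains c where "\<And>z. z \<in> S \<Longrightarrow> f z = c"
proof -
  have "(f has_derivative (\<lambda>h. 0)) (at z)" if "z \<in> S" for z
    using assms(3)[OF that] by (simp add: has_field_derivative_def lambda_zero)
  from has_derivative_zero_unique_connected[OF assms(1,2) this] that show ?thesis
    by metis
qed

section \<open>The three families of weights and the equation \<open>g'' = l g\<close>\<close>

text \<open>A complex phase shift balances the amplitudes: with \<open>s^2 = P / Q\<close>, both
  coefficients are \<open>P / s\<close> up to factors \<open>s\<close> and \<open>1 / s\<close>,
  which \<open>exp (\<plusminus> Ln s)\<close> absorbs into the argument of the sine.\<close>

lemma sin_from_exponentials:
  fixes P Q \<beta> :: complex
  assumes "P \<noteq> 0" "Q \<noteq> 0" "\<beta> \<noteq> 0"
  obtains a b c where "b \<noteq> 0" "a\<^sup>2 * b\<^sup>2 = P * Q"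
    "\<And>z. (P * exp (\<beta> * z) - Q * exp (- \<beta> * z)) / (2 * \<beta>) = a * sin (b * z + c)"
proof -
  define s where "s = csqrt (P / Q)"
  have s2: "s\<^sup>2 = P / Q" and s0: "s \<noteq> 0"
    using assms by (auto simp: s_def)
  have es: "exp (Ln s) = s"
    using s0 by simp
  define a where "a = \<i> * P / (\<beta> * s)"
  have "(P * exp (\<beta> * z) - Q * exp (- \<beta> * z)) / (2 * \<beta>) = a * sin (- \<i> * \<beta> * z + - \<i> * Ln s)" for z
  proof -
    have "\<i> * (- \<i> * \<beta> * z + - \<i> * Ln s) = \<beta> * z + Ln s"
      by (simp add: algebra_simps)
    then have "sin (- \<i> * \<beta> * z + - \<i> * Ln s) = (exp (\<beta> * z) * s - exp (- \<beta> * z) / s) / (2 * \<i>)"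
      unfolding sin_exp_eq by (simp add: exp_add exp_diff exp_minus es field_simps)
    moreover have "a * ((exp (\<beta> * z) * s - exp (- \<beta> * z) / s) / (2 * \<i>))
        = (P * exp (\<beta> * z) - P / s\<^sup>2 * exp (- \<beta> * z)) / (2 * \<beta>)"
      using assms s0 by (simp add: a_def field_simps power2_eq_square)
    ultimately show ?thesis
      using assms by (simp add: s2)
  qed
  moreover have "a\<^sup>2 * (- \<i> * \<beta>)\<^sup>2 = P\<^sup>2 / s\<^sup>2"
    using assms s0 by (simp add: a_def power_mult_distrib power_divide)
  then have "a\<^sup>2 * (- \<i> * \<beta>)\<^sup>2 = P * Q"
    unfolding s2 using assms by (simp add: power2_eq_square)
  ultimately show ?thesis
    using assms(3) by (intro that[of "- \<i> * \<beta>" a "- \<i> * Ln s"]) auto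
qed

text \<open>The reality conditions say that the constant \<open>g g'' - g'^2\<close> is real: it
  equals \<open>- a^2\<close> for the linear family, \<open>0\<close> for the exponential one and
  \<open>- a^2 b^2\<close> for the sine. Requiring \<open>b \<noteq> 0\<close> allows division by
  \<open>b\<close> when coordinates are moved.\<close>

definition weight_form :: "(complex \<Rightarrow> complex) \<Rightarrow> bool" where
  "weight_form g \<longleftrightarrow>
     (\<exists>a c. a\<^sup>2 \<in> \<real> \<and> g = (\<lambda>\<zeta>. a * \<zeta> + c))
   \<or> (\<exists>a b. b \<noteq> 0 \<and> g = (\<lambda>\<zeta>. a * exp (b * \<zeta>)))
   \<or> (\<exists>a b c. b \<noteq> 0 \<and> a\<^sup>2 * b\<^sup>2 \<in> \<real> \<and> g = (\<lambda>\<zeta>. a * sin (b * \<zeta> + c)))"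

lemma weight_form_holomorphic: "weight_form g \<Longrightarrow> g holomorphic_on S"
  unfolding weight_form_def by (auto intro!: holomorphic_intros)

text \<open>Rotating by \<open>- Arg b\<close> replaces \<open>b\<close> by its modulus, while
  \<open>a\<close> acquires the inverse factor, so \<open>a b\<close> is unchanged. Hence for the
  sine \<open>a^2\<close> becomes the real number \<open>a^2 b^2\<close> divided by a real square.
  For the exponential a translation normalizes the amplitude as well.\<close>

lemma weight_form_in_moved_coords:
  assumes "weight_form g"
  shows "\<exists>\<theta> p. (\<exists>a c. a\<^sup>2 \<in> \<real> \<and> in_moved_coords \<theta> p g = (\<lambda>w. a * w + c))
       \<or> (\<exists>a b. a\<^sup>2 \<in> \<real> \<and> b\<^sup>2 \<in> \<real> \<and> in_moved_coords \<theta> p g = (\<lambda>w. a * exp (b * w)))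
       \<or> (\<exists>a b c. a\<^sup>2 \<in> \<real> \<and> b\<^sup>2 \<in> \<real> \<and> in_moved_coords \<theta> p g = (\<lambda>w. a * sin (b * w + c)))"
proof -
  have rot: "b * cis (- Arg b) = of_real (cmod b)" for b
    by (metis cis_mult cis_zero mult.right_neutral mult.assoc add.right_inverse rcis_cmod_Arg rcis_def)
  consider (lin) a c where "a\<^sup>2 \<in> \<real>" "g = (\<lambda>\<zeta>. a * \<zeta> + c)"
    | (exp) a b where "b \<noteq> 0" "g = (\<lambda>\<zeta>. a * exp (b * \<zeta>))"
    | (sin) a b c where "b \<noteq> 0" "a\<^sup>2 * b\<^sup>2 \<in> \<real>" "g = (\<lambda>\<zeta>. a * sin (b * \<zeta> + c))"
    using assms unfolding weight_form_def by blast
  then show ?thesis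
  proof cases
    case lin
    then have "in_moved_coords 0 0 g = (\<lambda>w. a * w + c)"
      by (simp add: in_moved_coords_def)
    with lin show ?thesis
      by blast
  next
    case exp
    define \<theta> where "\<theta> = - Arg b"
    define q where "q = cis (- \<theta>) * a"
    \<comment> \<open>Chosen so that \<open>exp (b * p) = 1 / q\<close>, which makes the amplitude
      \<open>1\<close>. If \<open>a = 0\<close> then \<open>q = 0\<close>, and the amplitude is
      \<open>0\<close> whatever the value of \<open>Ln 0\<close>.\<close>
    define p where "p = - Ln q / b"
    define A where "A = q * exp (b * p)"
    have "A = (if q = 0 then 0 else 1)"
      using exp(1) by (simp add: A_def p_def exp_minus)
    then have "A\<^sup>2 \<in> \<real>"
      by simp
    moreover have "(b * cis \<theta>)\<^sup>2 \<in> \<real>"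
      by (simp add: \<theta>_def rot)
    moreover have "in_moved_coords \<theta> p g = (\<lambda>w. A * exp (b * cis \<theta> * w))"
      by (simp add: in_moved_coords_def exp(2) A_def q_def exp_add[symmetric] algebra_simps)
    ultimately show ?thesis
      by blast
  next
    case sin
    define \<theta> where "\<theta> = - Arg b"
    have b: "(b * cis \<theta>)\<^sup>2 \<in> \<real>"
      by (simp add: \<theta>_def rot)
    have "cis (- \<theta>) * cis \<theta> = 1"
      by (simp add: cis_mult)
    then have "(cis (- \<theta>) * a)\<^sup>2 * (b * cis \<theta>)\<^sup>2 = a\<^sup>2 * b\<^sup>2"
      by (metis (no_types, lifting) mult.assoc mult.commute mult.left_neutral power_mult_distrib)
    then have "(cis (- \<theta>) * a)\<^sup>2 = a\<^sup>2 * b\<^sup>2 / (b * cis \<theta>)\<^sup>2"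
      using sin(1) by (simp add: eq_divide_eq)
    then have "(cis (- \<theta>) * a)\<^sup>2 \<in> \<real>"
      using b sin(2) by (simp only: Reals_divide)
    moreover have "in_moved_coords \<theta> 0 g = (\<lambda>w. cis (- \<theta>) * a * sin (b * cis \<theta> * w + c))"
      by (simp add: in_moved_coords_def sin(3) algebra_simps)
    ultimately show ?thesis
      using b by blast
  qed
qed

text \<open>With \<open>\<beta>^2 = l\<close>, the functions \<open>g' + \<beta> g\<close> and
  \<open>g' - \<beta> g\<close> are multiples \<open>P\<close> and \<open>Q\<close> of
  \<open>exp (\<beta> z)\<close> and \<open>exp (- \<beta> z)\<close>. Their product
  \<open>g'^2 - l g^2\<close> is the constant \<open>P Q\<close>, so reality at the single point
  \<open>z1\<close> makes \<open>P Q\<close> real.\<close>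

lemma weight_form_of_linear_ode:
  assumes S: "open S" "connected S" "z1 \<in> S"
    and g: "\<And>z. z \<in> S \<Longrightarrow> (g has_field_derivative g' z) (at z)"
    and g': "\<And>z. z \<in> S \<Longrightarrow> (g' has_field_derivative l * g z) (at z)"
    and E: "Im (l * (g z1)\<^sup>2 - (g' z1)\<^sup>2) = 0"
  obtains g0 where "weight_form g0" "\<And>z. z \<in> S \<Longrightarrow> g z = g0 z"
proof (cases "l = 0")
  case True
  obtain a where a: "\<And>z. z \<in> S \<Longrightarrow> g' z = a"
    using constant_of_DERIV_zero[OF S(1,2), of g'] g' True by auto
  have "((\<lambda>z. g z - a * z) has_field_derivative 0) (at z)" if "z \<in> S" for z
    using g[OF that] a[OF that] by (auto intro!: derivative_eq_intros)
  then obtain c where c: "\<And>z. z \<in> S \<Longrightarrow> g z - a * z = c"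
    using constant_of_DERIV_zero[OF S(1,2)] by metis
  have "a\<^sup>2 \<in> \<real>"
    using E True a[OF S(3)] by (simp add: complex_is_Real_iff)
  then have "weight_form (\<lambda>z. a * z + c)"
    unfolding weight_form_def by blast
  moreover have "g z = a * z + c" if "z \<in> S" for z
    using c[OF that] by (simp add: algebra_simps)
  ultimately show ?thesis
    using that by blast
next
  case False
  define \<beta> where "\<beta> = csqrt l"
  have \<beta>: "l = \<beta>\<^sup>2" "\<beta> \<noteq> 0"
    using False by (auto simp: \<beta>_def)
  \<comment> \<open>If \<open>\<mu>^2 = l\<close> then
    \<open>(g' + \<mu> g)' = \<mu> (g' + \<mu> g)\<close>, so \<open>exp (- \<mu> z)\<close> is an
    integrating factor. It is used for both square roots of \<open>l\<close>.\<close>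
  have const: "\<exists>P. \<forall>z\<in>S. g' z + \<mu> * g z = P * exp (\<mu> * z)" if \<mu>: "\<mu>\<^sup>2 = l" for \<mu>
  proof -
    have "((\<lambda>z. (g' z + \<mu> * g z) * exp (- \<mu> * z)) has_field_derivative 0) (at z)" if "z \<in> S" for z
      by (rule derivative_eq_intros g[OF that] g'[OF that] refl)+
        (simp add: \<mu>[symmetric] power2_eq_square algebra_simps)
    then obtain P where "\<And>z. z \<in> S \<Longrightarrow> (g' z + \<mu> * g z) * exp (- \<mu> * z) = P"
      by (rule constant_of_DERIV_zero[OF S(1,2)]) blast+
    moreover have "w = w * exp (- \<mu> * z) * exp (\<mu> * z)" for w z
      by (simp add: exp_minus)
    ultimately show ?thesis
      by metis
  qed
  obtain P where P: "\<And>z. z \<in> S \<Longrightarrow> g' z + \<beta> * g z = P * exp (\<beta> * z)"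
    using const[of \<beta>] \<beta> by auto
  obtain Q where Q: "\<And>z. z \<in> S \<Longrightarrow> g' z - \<beta> * g z = Q * exp (- \<beta> * z)"
    using const[of "- \<beta>"] \<beta> by auto
  have sol: "g z = (P * exp (\<beta> * z) - Q * exp (- \<beta> * z)) / (2 * \<beta>)" if "z \<in> S" for z
    unfolding P[OF that, symmetric] Q[OF that, symmetric] using \<beta> by (simp add: field_simps)
  have "l * (g z1)\<^sup>2 - (g' z1)\<^sup>2 = - ((g' z1 + \<beta> * g z1) * (g' z1 - \<beta> * g z1))"
    by (simp add: \<beta> power2_eq_square algebra_simps)
  also have "\<dots> = - (P * Q)"
    unfolding P[OF S(3)] Q[OF S(3)] by (simp add: exp_minus)
  finally have PQ: "P * Q \<in> \<real>"
    using E by (simp add: complex_is_Real_iff)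
  show ?thesis
  \<comment> \<open>One surviving exponential gives the exponential family, including
    \<open>g = 0\<close> with amplitude \<open>0\<close>; two give the sine.\<close>
  proof (cases "P = 0 \<or> Q = 0")
    case True
    then obtain a b where "b \<noteq> 0" "\<And>z. (P * exp (\<beta> * z) - Q * exp (- \<beta> * z)) / (2 * \<beta>) = a * exp (b * z)"
    proof
      assume "P = 0"
      then show ?thesis
        using \<beta> by (intro that[of "- \<beta>" "- Q / (2 * \<beta>)"]) auto
    next
      assume "Q = 0"
      then show ?thesis
        using \<beta> by (intro that[of \<beta> "P / (2 * \<beta>)"]) auto
    qed
    then show ?thesis
      using sol by (intro that[of "\<lambda>z. a * exp (b * z)"]) (auto simp: weight_form_def)
  next
    case False
    then obtain a b c where abc: "b \<noteq> 0" "a\<^sup>2 * b\<^sup>2 = P * Q"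
      "\<And>z. (P * exp (\<beta> * z) - Q * exp (- \<beta> * z)) / (2 * \<beta>) = a * sin (b * z + c)"
      using sin_from_exponentials[of P Q \<beta>] \<beta> by metis
    then have "weight_form (\<lambda>z. a * sin (b * z + c))"
      using PQ unfolding weight_form_def by metis
    then show ?thesis
      using sol abc(3) that by simp
  qed
qed

text \<open>A holomorphic function with zero imaginary part has zero derivative, here
  \<open>g g''' - g' g'' = 0\<close>. This is the numerator of \<open>(g'' / g)'\<close>, so
  \<open>g'' = l g\<close>, and the hypothesis at one point supplies the reality condition of the
  linear equation.\<close>

lemma weight_form_of_real_ode:
  assumes S: "open S" "connected S" "S \<noteq> {}"
    and g: "g holomorphic_on S" "\<And>z. z \<in> S \<Longrightarrow> g z \<noteq> 0"
    and E: "\<And>z. z \<in> S \<Longrightarrow> Im (g z * deriv (deriv g) z - (deriv g z)\<^sup>2) = 0"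
  obtains g0 where "weight_form g0" "\<And>z. z \<in> S \<Longrightarrow> g z = g0 z"
proof -
  define g1 where "g1 = deriv g"
  define g2 where "g2 = deriv g1"
  have holo: "g1 holomorphic_on S" "g2 holomorphic_on S"
    using g S by (auto simp: g1_def g2_def intro!: holomorphic_deriv)
  have D0: "(g has_field_derivative g1 z) (at z)"
    and D1: "(g1 has_field_derivative g2 z) (at z)"
    and D2: "(g2 has_field_derivative deriv g2 z) (at z)" if "z \<in> S" for z
    using that g holo S unfolding g1_def g2_def by (auto intro: holomorphic_derivI)
  have g3: "g z * deriv g2 z = g1 z * g2 z" if z: "z \<in> S" for z
  proof -
    have "((\<lambda>z. g z * g2 z - (g1 z)\<^sup>2) has_field_derivative g z * deriv g2 z - g1 z * g2 z) (at z)"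
      by (rule derivative_eq_intros D0 D1 D2 z refl)+ (simp add: algebra_simps)
    moreover have "deriv (\<lambda>z. g z * g2 z - (g1 z)\<^sup>2) z = 0"
      using E g(1) holo
      by (intro holomorphic_on_Im_zero_deriv_zero[OF S(1) z])
        (auto simp: g1_def g2_def intro!: holomorphic_intros)
    ultimately show ?thesis
      using DERIV_imp_deriv by fastforce
  qed
  have "((\<lambda>z. g2 z / g z) has_field_derivative 0) (at z)" if z: "z \<in> S" for z
    by (rule derivative_eq_intros D0 D2 z refl g(2))+ (use g3[OF z] in \<open>simp add: mult.commute\<close>)
  then obtain l where "\<And>z. z \<in> S \<Longrightarrow> g2 z / g z = l"
    using constant_of_DERIV_zero[OF S(1,2)] by metis
  then have l: "g2 z = l * g z" if "z \<in> S" for z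
    using that g(2) by (auto simp: field_simps)
  obtain z1 where z1: "z1 \<in> S"
    using S(3) by blast
  have "Im (l * (g z1)\<^sup>2 - (g1 z1)\<^sup>2) = 0"
    using E[OF z1] l[OF z1] by (simp add: g1_def[symmetric] g2_def[symmetric] power2_eq_square mult_ac)
  from weight_form_of_linear_ode[OF S(1,2) z1 D0 _ this] D1 l that show ?thesis
    by metis
qed

text \<open>Along a level curve of \<open>\<phi>\<close> through \<open>z0\<close>, whose velocity is \<open>\<i> g\<close>, the factor \<open>K (\<phi> z)\<close>
  is constant, so the hypothesis can be differentiated although nothing is known about \<open>K\<close>.\<close>

lemma real_ode_of_level_dependence:
  assumes S: "open S" "z0 \<in> S"
    and g: "g holomorphic_on S" "\<And>z. z \<in> S \<Longrightarrow> g z \<noteq> 0"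
    and deriv: "\<And>z. z \<in> S \<Longrightarrow> (\<phi> has_derivative (\<lambda>h. Re (1 / g z * h))) (at z)"
    and K: "\<And>z. z \<in> S \<Longrightarrow> Re (deriv g z) = K (\<phi> z) * (cmod (g z))\<^sup>2"
  shows "Im (g z0 * deriv (deriv g) z0 - (deriv g z0)\<^sup>2) = 0"
proof -
  \<comment> \<open>The level curve is taken for the gradient \<open>1 / g\<close>, which gives it
    the velocity \<open>\<i> / (1 / g) = \<i> g\<close>.\<close>
  have "(\<lambda>z. 1 / g z) holomorphic_on S" "1 / g z0 \<noteq> 0"
    using g S by (auto intro!: holomorphic_intros)
  from level_curve[OF S this deriv]
  obtain \<gamma> where \<gamma>: "\<gamma> 0 = z0" "(\<gamma> has_vector_derivative \<i> * g z0) (at 0)"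
    "\<forall>\<^sub>F t in nhds (0 :: real). \<gamma> t \<in> S \<and> \<phi> (\<gamma> t) = \<phi> z0"
    by (auto simp: field_simps)
  have "(g has_field_derivative deriv g z0) (at (\<gamma> 0))"
    and "(deriv g has_field_derivative deriv (deriv g) z0) (at (\<gamma> 0))"
    using S g \<gamma>(1) by (auto intro!: holomorphic_derivI holomorphic_deriv)
  from this[THEN field_vector_diff_chain_at[OF \<gamma>(2)]]
  have 1: "((\<lambda>t. g (\<gamma> t)) has_vector_derivative \<i> * g z0 * deriv g z0) (at 0)"
    and 2: "((\<lambda>t. deriv g (\<gamma> t)) has_vector_derivative \<i> * g z0 * deriv (deriv g) z0) (at 0)"
    by (simp_all add: o_def)
  define k where "k = K (\<phi> z0)"
  have "((\<lambda>t. Re (deriv g (\<gamma> t))) has_field_derivative Re (\<i> * g z0 * deriv (deriv g) z0)) (at 0)"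
    using 2 by (simp add: has_vector_derivative_complex_iff)
  moreover have "((\<lambda>t. k * ((p t)\<^sup>2 + (q t)\<^sup>2)) has_field_derivative
      k * (2 * p 0 * p' + 2 * q 0 * q')) (at 0)"
    if "(p has_field_derivative p') (at 0)" "(q has_field_derivative q') (at 0)" for p q :: "real \<Rightarrow> real" and p' q'
    using that by (auto intro!: derivative_eq_intros)
  from this[of "\<lambda>t. Re (g (\<gamma> t))" _ "\<lambda>t. Im (g (\<gamma> t))"] 1[unfolded has_vector_derivative_complex_iff]
  have "((\<lambda>t. k * ((Re (g (\<gamma> t)))\<^sup>2 + (Im (g (\<gamma> t)))\<^sup>2)) has_field_derivative
      k * (2 * Re (g z0) * Re (\<i> * g z0 * deriv g z0) + 2 * Im (g z0) * Im (\<i> * g z0 * deriv g z0))) (at 0)"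
    unfolding \<gamma>(1) by blast
  moreover have ev: "\<forall>\<^sub>F t in nhds 0. Re (deriv g (\<gamma> t)) = k * ((Re (g (\<gamma> t)))\<^sup>2 + (Im (g (\<gamma> t)))\<^sup>2)"
    using \<gamma>(3) by eventually_elim (simp add: K k_def cmod_power2)
  ultimately have "Re (\<i> * g z0 * deriv (deriv g) z0) =
      k * (2 * Re (g z0) * Re (\<i> * g z0 * deriv g z0) + 2 * Im (g z0) * Im (\<i> * g z0 * deriv g z0))"
    by (metis (no_types, lifting) DERIV_cong_ev[OF refl ev refl] DERIV_unique)
  \<comment> \<open>Along the curve the derivative of \<open>|g|^2\<close> is
    \<open>2 Re (cnj g * \<i> g g') = - 2 |g|^2 Im g'\<close>.\<close>
  also have "\<dots> = - 2 * (k * (cmod (g z0))\<^sup>2) * Im (deriv g z0)"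
    by (simp add: cmod_power2) (simp add: power2_eq_square algebra_simps)
  also have "\<dots> = - 2 * Re (deriv g z0) * Im (deriv g z0)"
    using K[OF S(2)] by (simp add: k_def)
  \<comment> \<open>The two ends of the chain are \<open>- Im (g g'')\<close> and
    \<open>- Im (g'^2)\<close>.\<close>
  finally show ?thesis
    by (simp add: power2_eq_square algebra_simps)
qed

section \<open>The zero mean curvature equation for \<open>F \<circ> \<phi>\<close>\<close>

text \<open>After substitution the terms with \<open>F'^2 F''\<close> cancel, leaving
  \<open>F'' |\<nabla>\<phi>|^2\<close>; the term \<open>F' \<Delta>\<phi>\<close> vanishes. The
  cubic terms combine, by \<open>\<phi>_yy = - \<phi>_xx\<close>, into the real part of
  \<open>f' (cnj f)^2\<close> with \<open>f = \<phi>_x - i \<phi>_y\<close>.\<close>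

lemma zmc_solution_on_composition:
  assumes "open D" "harmonic_on \<phi> D" "zmc_solution_on u D"
    and F: "\<And>t. t \<in> \<phi> ` D \<Longrightarrow> F differentiable (at t)"
    and F': "\<And>t. t \<in> \<phi> ` D \<Longrightarrow> deriv F differentiable (at t)"
    and u: "\<And>z. z \<in> D \<Longrightarrow> u z = F (\<phi> z)"
    and z: "z \<in> D"
  shows "deriv (deriv F) (\<phi> z) * (cmod (Complex (dx \<phi> z) (- dy \<phi> z)))\<^sup>2
    + (deriv F (\<phi> z)) ^ 3 *
      Re (Complex (dx (dx \<phi>) z) (- dy (dx \<phi>) z) * (cnj (Complex (dx \<phi> z) (- dy \<phi> z)))\<^sup>2) = 0"
proof -
  \<comment> \<open>Stated for general \<open>v\<close> and \<open>G\<close> because it serves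
    twice: for \<open>u = F \<circ> \<phi>\<close> and for \<open>F' \<circ> \<phi>\<close>.\<close>
  have chain: "(v has_derivative (\<lambda>h. deriv G (\<phi> w) * (dx \<phi> w * Re h + dy \<phi> w * Im h))) (at w)"
    if "w \<in> D" "G differentiable (at (\<phi> w))" "\<And>w. w \<in> D \<Longrightarrow> v w = G (\<phi> w)" for v G w
  proof (rule has_derivative_transform_within_open[OF _ assms(1) that(1)])
    have "\<phi> differentiable (at w)"
      using assms that by (auto simp: harmonic_on_def twice_differentiable_on_def intro: differentiable_at_of_open)
    then have "(\<phi> has_derivative (\<lambda>h. dx \<phi> w * Re h + dy \<phi> w * Im h)) (at w)"
      by (rule has_derivative_dx_dy)
    moreover have "(G has_field_derivative deriv G (\<phi> w)) (at (\<phi> w))"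
      using that(2) by (simp add: DERIV_deriv_iff_real_differentiable)
    ultimately show "((\<lambda>w. G (\<phi> w)) has_derivative
        (\<lambda>h. deriv G (\<phi> w) * (dx \<phi> w * Re h + dy \<phi> w * Im h))) (at w)"
      unfolding has_field_derivative_def by (rule has_derivative_compose)
  qed (use that in auto)
  have ux: "dx u w = deriv F (\<phi> w) * dx \<phi> w" and uy: "dy u w = deriv F (\<phi> w) * dy \<phi> w" if "w \<in> D" for w
    using dx_eqI[OF chain[where w = w and v = u and G = F]] dy_eqI[OF chain[where w = w and v = u and G = F]]
      F u that by auto
  have F'': "((\<lambda>w. deriv F (\<phi> w)) has_derivative
      (\<lambda>h. deriv (deriv F) (\<phi> z) * (dx \<phi> z * Re h + dy \<phi> z * Im h))) (at z)"
    by (rule chain[OF z]) (use F' z in auto)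
  have \<phi>2: "dx \<phi> differentiable (at z)" "dy \<phi> differentiable (at z)"
    using assms by (auto simp: harmonic_on_def twice_differentiable_on_def intro: differentiable_at_of_open)
  have D1: "(dx u has_derivative (\<lambda>h. deriv F (\<phi> z) * (dx (dx \<phi>) z * Re h + dy (dx \<phi>) z * Im h)
      + deriv (deriv F) (\<phi> z) * (dx \<phi> z * Re h + dy \<phi> z * Im h) * dx \<phi> z)) (at z)"
    by (rule has_derivative_transform_within_open[OF _ assms(1) z, where f = "\<lambda>w. deriv F (\<phi> w) * dx \<phi> w"])
      (intro has_derivative_mult F'' has_derivative_dx_dy \<phi>2, simp add: ux)
  have D2: "(dy u has_derivative (\<lambda>h. deriv F (\<phi> z) * (dx (dy \<phi>) z * Re h + dy (dy \<phi>) z * Im h)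
      + deriv (deriv F) (\<phi> z) * (dx \<phi> z * Re h + dy \<phi> z * Im h) * dy \<phi> z)) (at z)"
    by (rule has_derivative_transform_within_open[OF _ assms(1) z, where f = "\<lambda>w. deriv F (\<phi> w) * dy \<phi> w"])
      (intro has_derivative_mult F'' has_derivative_dx_dy \<phi>2, simp add: uy)
  have lap: "dy (dy \<phi>) z = - dx (dx \<phi>) z"
    using assms by (simp add: harmonic_on_def eq_neg_iff_add_eq_0 add.commute)
  have "(1 - (dy u z)\<^sup>2) * dx (dx u) z + 2 * dx u z * dy u z * dy (dx u) z
             + (1 - (dx u z)\<^sup>2) * dy (dy u) z = 0"
    using assms by (simp add: zmc_solution_on_def)
  then show ?thesis
    unfolding ux[OF z] uy[OF z] dx_eqI[OF D1] dy_eqI[OF D1] dy_eqI[OF D2]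
    by (simp add: lap cmod_power2) (simp add: power2_eq_square power3_eq_cube algebra_simps)
qed

section \<open>Classification near a regular point of \<open>u\<close> and continuation to
  \<open>D\<close>\<close>

text \<open>In the given coordinate only the invariants \<open>a^2\<close> (linear) and
  \<open>a^2 b^2\<close> (sine) are real; reality of \<open>a^2\<close> and \<open>b^2\<close>
  separately is obtained after a rigid motion. A constant \<open>u\<close> must be excluded, since
  constant \<open>F\<close> solves the equation with every harmonic \<open>\<phi>\<close>.\<close>

theorem theorem2:
  fixes D :: "complex set" and u \<phi> :: "complex \<Rightarrow> real" and F :: "real \<Rightarrow> real"
  assumes "open D" and "connected D"
    and "harmonic_on \<phi> D"
    and "\<And>t. t \<in> \<phi> ` D \<Longrightarrow> F differentiable (at t)"
    and "\<And>t. t \<in> \<phi> ` D \<Longrightarrow> deriv F differentiable (at t)"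
    and "\<And>z. z \<in> D \<Longrightarrow> u z = F (\<phi> z)"
    and "zmc_solution_on u D"
    and "\<not> u constant_on D"
  shows "\<exists>g :: complex \<Rightarrow> complex.
      Re_integral_of_reciprocal \<phi> g D
    \<and> ((\<exists>a c. a\<^sup>2 \<in> \<real> \<and> g = (\<lambda>\<zeta>. a * \<zeta> + c))
       \<or> (\<exists>a b. g = (\<lambda>\<zeta>. a * exp (b * \<zeta>)))
       \<or> (\<exists>a b c. a\<^sup>2 * b\<^sup>2 \<in> \<real> \<and> g = (\<lambda>\<zeta>. a * sin (b * \<zeta> + c))))
    \<and> (\<exists>\<theta> p. (\<exists>a c. a\<^sup>2 \<in> \<real> \<and> in_moved_coords \<theta> p g = (\<lambda>w. a * w + c))
       \<or> (\<exists>a b. a\<^sup>2 \<in> \<real> \<and> b\<^sup>2 \<in> \<real> \<and> in_moved_coords \<theta> p g = (\<lambda>w. a * exp (b * w)))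
       \<or> (\<exists>a b c. a\<^sup>2 \<in> \<real> \<and> b\<^sup>2 \<in> \<real> \<and> in_moved_coords \<theta> p g = (\<lambda>w. a * sin (b * w + c))))
    \<and> (\<forall>\<zeta>\<in>D. deriv (deriv F) (\<phi> \<zeta>)
               - Re (deriv g \<zeta>) / (cmod (g \<zeta>))\<^sup>2 * (deriv F (\<phi> \<zeta>)) ^ 3 = 0)"
proof -
  note \<phi> = assms(1,3)
  define f where "f z = Complex (dx \<phi> z) (- dy \<phi> z)" for z
  define f1 where "f1 z = Complex (dx (dx \<phi>) z) (- dy (dx \<phi>) z)" for z
  have f_deriv: "(f has_field_derivative f1 z) (at z)" if "z \<in> D" for z
    using harmonic_on_gradient_has_field_derivative[OF \<phi> that] by (simp add: f_def[abs_def] f1_def)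
  then have f_holo: "f holomorphic_on D"
    by (meson holomorphic_onI field_differentiable_def field_differentiable_at_within)
  have grad: "(\<phi> has_derivative (\<lambda>h. Re (f z * h))) (at z)" if "z \<in> D" for z
    using harmonic_on_has_derivative[OF \<phi> that] by (simp add: f_def)
  have F1: "(F has_field_derivative deriv F (\<phi> z)) (at (\<phi> z))" if "z \<in> D" for z
    using assms(4) that by (simp add: DERIV_deriv_iff_real_differentiable)
  have pde: "deriv (deriv F) (\<phi> z) * (cmod (f z))\<^sup>2 + (deriv F (\<phi> z)) ^ 3 * Re (f1 z * (cnj (f z))\<^sup>2) = 0"
    if "z \<in> D" for z
    using zmc_solution_on_composition[OF \<phi> assms(7,4,5,6) that] by (simp only: f_def f1_def)
  \<comment> \<open>Here \<open>- f1 / f^2\<close> is the derivative of \<open>1 / f\<close>, so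
    this is the equation for \<open>F\<close> with \<open>g = 1 / f\<close>, so far only where
    \<open>f \<noteq> 0\<close>. It is \<open>pde\<close> divided by \<open>|f|^2\<close>.\<close>
  have weight: "deriv (deriv F) (\<phi> z) - Re (- f1 z / (f z)\<^sup>2) * (cmod (f z))\<^sup>2 * (deriv F (\<phi> z)) ^ 3 = 0"
    if z: "z \<in> D" "f z \<noteq> 0" for z
  proof -
    have "f1 z / (f z)\<^sup>2 = f1 z * (cnj (f z))\<^sup>2 / of_real ((cmod (f z)) ^ 4)"
      by (subst complex_div_cnj) (simp add: norm_power)
    then have "Re (- f1 z / (f z)\<^sup>2) = - Re (f1 z * (cnj (f z))\<^sup>2) / (cmod (f z)) ^ 4"
      by (simp only: minus_divide_left[symmetric] uminus_complex.simps Re_divide_of_real)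
    then have "Re (- f1 z / (f z)\<^sup>2) * (cmod (f z))\<^sup>2 * (deriv F (\<phi> z)) ^ 3
        = - ((deriv F (\<phi> z)) ^ 3 * Re (f1 z * (cnj (f z))\<^sup>2)) / (cmod (f z))\<^sup>2"
      using z(2) by (simp add: field_simps power2_eq_square power4_eq_xxxx)
    also have "\<dots> = deriv (deriv F) (\<phi> z) * (cmod (f z))\<^sup>2 / (cmod (f z))\<^sup>2"
      using pde[OF z(1)] by (intro arg_cong[where f = "\<lambda>x. x / (cmod (f z))\<^sup>2"]) linarith
    finally show ?thesis
      using z(2) by simp
  qed
  \<comment> \<open>Otherwise the differential \<open>F'(\<phi>) Re (f dz)\<close> of
    \<open>u\<close> vanishes throughout the connected set \<open>D\<close>, and \<open>u\<close> is
    constant.\<close>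
  obtain z0 where z0: "z0 \<in> D" "deriv F (\<phi> z0) \<noteq> 0" "f z0 \<noteq> 0"
  proof (rule ccontr)
    assume "\<not> thesis"
    with that have zero: "deriv F (\<phi> z) = 0 \<or> f z = 0" if "z \<in> D" for z
      using \<open>z \<in> D\<close> by blast
    have "((\<lambda>z. F (\<phi> z)) has_derivative (\<lambda>h. 0)) (at z)" if "z \<in> D" for z
    proof -
      have "((\<lambda>z. F (\<phi> z)) has_derivative (\<lambda>h. deriv F (\<phi> z) * Re (f z * h))) (at z)"
        by (rule has_derivative_compose[OF grad F1[unfolded has_field_derivative_def]]) (fact that)+
      then show ?thesis
        using zero[OF that] by auto
    qed
    from has_derivative_zero_unique_connected[OF assms(1,2) this]
    have "u constant_on D"
      unfolding constant_on_def using assms(6) by metis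
    with assms(8) show False ..
  qed
  define S where "S = {z \<in> D. f z * of_real (deriv F (\<phi> z)) \<noteq> 0}"
  have "continuous_on D (\<lambda>z. deriv F (\<phi> z))"
  proof (intro continuous_at_imp_continuous_on ballI)
    fix z assume "z \<in> D"
    then have "isCont (deriv F) (\<phi> z)" "isCont \<phi> z"
      using assms(5) grad by (auto intro: differentiable_imp_continuous_within has_derivative_continuous)
    then show "isCont (\<lambda>z. deriv F (\<phi> z)) z"
      by (rule isCont_o2[rotated])
  qed
  then have "continuous_on D (\<lambda>z. f z * of_real (deriv F (\<phi> z)))"
    using f_holo by (intro continuous_intros holomorphic_on_imp_continuous_on) auto
  from continuous_open_preimage[OF this assms(1), of "- {0}"]
  have "open S"
    by (simp add: S_def vimage_def Int_def open_Compl)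
  then obtain r where r: "r > 0" "ball z0 r \<subseteq> S"
    using z0 open_contains_ball[of S] by (auto simp: S_def)
  define B where "B = ball z0 r"
  have B: "z \<in> D" "f z \<noteq> 0" "deriv F (\<phi> z) \<noteq> 0" if "z \<in> B" for z
    using r that by (auto simp: B_def S_def)
  have B_open: "open B" "connected B" "B \<noteq> {}"
    using r by (auto simp: B_def)
  have recip_deriv: "((\<lambda>z. 1 / f z) has_field_derivative - f1 z / (f z)\<^sup>2) (at z)" if "z \<in> D" "f z \<noteq> 0" for z
    using DERIV_divide[OF DERIV_const[of 1] f_deriv[OF that(1)] that(2)] by (simp add: power2_eq_square)
  have "B \<subseteq> D"
    using B by blast
  then have "f holomorphic_on B"
    by (rule holomorphic_on_subset[OF f_holo])
  then have recip_holo: "(\<lambda>z. 1 / f z) holomorphic_on B"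
    using B by (intro holomorphic_intros)
  \<comment> \<open>On \<open>B\<close> one may divide by \<open>F'^3\<close>, so
    \<open>Re g' / |g|^2 = F'' / F'^3\<close> is a function of \<open>\<phi>\<close> alone; this
    quotient is the \<open>K\<close> supplied.\<close>
  have "Im (1 / f z * deriv (deriv (\<lambda>z. 1 / f z)) z - (deriv (\<lambda>z. 1 / f z) z)\<^sup>2) = 0" if "z \<in> B" for z
  proof (rule real_ode_of_level_dependence[OF B_open(1) that recip_holo,
        where \<phi> = \<phi> and K = "\<lambda>t. deriv (deriv F) t / (deriv F t) ^ 3"])
    fix w assume w: "w \<in> B"
    show "(\<phi> has_derivative (\<lambda>h. Re (1 / (1 / f w) * h))) (at w)"
      using grad[OF B(1)[OF w]] by simp
    show "1 / f w \<noteq> 0"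
      using B[OF w] by simp
    show "Re (deriv (\<lambda>z. 1 / f z) w) = deriv (deriv F) (\<phi> w) / (deriv F (\<phi> w)) ^ 3 * (cmod (1 / f w))\<^sup>2"
      unfolding DERIV_imp_deriv[OF recip_deriv[OF B(1,2)[OF w]]]
      using weight[OF B(1,2)[OF w]] B[OF w] by (simp add: field_simps norm_divide power_divide)
  qed
  moreover have "1 / f z \<noteq> 0" if "z \<in> B" for z
    using B[OF that] by simp
  ultimately obtain g where g: "weight_form g" "\<And>z. z \<in> B \<Longrightarrow> 1 / f z = g z"
    using weight_form_of_real_ode[OF B_open recip_holo] by metis
  \<comment> \<open>The product is continued rather than \<open>1 / f\<close>: it is holomorphic on
    all of \<open>D\<close> even before zeros of \<open>f\<close> are excluded, and
    \<open>f g = 1\<close> then excludes them.\<close>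
  have fg: "f z * g z = 1" if "z \<in> D" for z
  proof (rule analytic_continuation_open[OF B_open(1) assms(1) B_open(3) assms(2) _ _ _ _ that])
    show "B \<subseteq> D"
      by fact
    show "(\<lambda>z. f z * g z) holomorphic_on D"
      using f_holo weight_form_holomorphic[OF g(1)] by (intro holomorphic_intros)
    show "f w * g w = 1" if "w \<in> B" for w
      using g(2)[OF that, symmetric] B[OF that] by simp
  qed (simp add: holomorphic_on_const)
  have nz: "f z \<noteq> 0" "g z \<noteq> 0" "g z = 1 / f z" "1 / g z = f z" if "z \<in> D" for z
    using fg[OF that] by (auto simp: divide_simps mult.commute)
  have "Re_integral_of_reciprocal \<phi> g D"
    unfolding Re_integral_of_reciprocal_def
  proof (intro conjI ballI allI impI)
    show "g z \<noteq> 0" if "z \<in> D" for z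
      using nz that by blast
    fix \<gamma> assume \<gamma>: "valid_path \<gamma> \<and> path_image \<gamma> \<subseteq> D"
    have "(\<lambda>z. 1 / g z) holomorphic_on D"
      using nz weight_form_holomorphic[OF g(1)] by (intro holomorphic_intros) auto
    then show int: "(\<lambda>z. 1 / g z) contour_integrable_on \<gamma>"
      using contour_integrable_holomorphic_simple assms(1) \<gamma> by blast
    show "\<phi> (pathfinish \<gamma>) - \<phi> (pathstart \<gamma>) = Re (contour_integral \<gamma> (\<lambda>z. 1 / g z))"
      by (rule contour_integral_gradient[OF int, of D]) (use \<gamma> grad nz in auto)
  qed
  moreover have "deriv (deriv F) (\<phi> z) - Re (deriv g z) / (cmod (g z))\<^sup>2 * (deriv F (\<phi> z)) ^ 3 = 0"
    if z: "z \<in> D" for z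
  proof -
    have "(g has_field_derivative - f1 z / (f z)\<^sup>2) (at z)"
      by (rule has_field_derivative_transform_within_open[OF recip_deriv[OF z nz(1)[OF z]] assms(1) z])
        (use nz in auto)
    then have "deriv g z = - f1 z / (f z)\<^sup>2"
      by (rule DERIV_imp_deriv)
    then show ?thesis
      using weight[OF z nz(1)[OF z]] by (simp add: nz(3)[OF z] norm_divide power_divide)
  qed
  moreover have "(\<exists>a c. a\<^sup>2 \<in> \<real> \<and> g = (\<lambda>\<zeta>. a * \<zeta> + c))
       \<or> (\<exists>a b. g = (\<lambda>\<zeta>. a * exp (b * \<zeta>)))
       \<or> (\<exists>a b c. a\<^sup>2 * b\<^sup>2 \<in> \<real> \<and> g = (\<lambda>\<zeta>. a * sin (b * \<zeta> + c)))"
    using g(1) unfolding weight_form_def by blast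
  ultimately show ?thesis
    using weight_form_in_moved_coords[OF g(1)] by blast
qed

end
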